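(* Let $k$ be a rig of characteristic zero. Let $\mathbf{A}$ and $\mathbf{B}$ be patch-finite (small) categories with coarse Möbius inversion over $k$. Let $F:\mathbf{A}\to\mathbf{B}$ and $G:\mathbf{B}\to\mathbf{A}$ be functors with finite fibres, with $F$ left adjoint to $G$. Then for all objects $a\in\mathbf{A}$ and $b\in\mathbf{B}$, $$\sum_{a'\,:\,F(a')=b}\mu_{\mathbf{A}}(a,a')=\sum_{b'\,:\,G(b')=a}\mu_{\mathbf{B}}(b',b),$$ where $a'$ ranges over objects of $\mathbf{A}$, $b'$ over objects of $\mathbf{B}$, and $\mu_{\mathbf{A}},\mu_{\mathbf{B}}$ are the coarse Möbius functions.
   Context: A rig is a set with a commutative monoid structure $(+,0)$ and a commutative monoid structure $(\cdot,1)$, the latter distributing over the former (including $0\cdot x=0$). It has characteristic zero if $0$ is the only natural number $n$ with $n\cdot 1=0$ in $k$; a natural number $n$ is also regarded as the element $n\cdot 1\in k$. A functor $F:\mathbf{A}\to\mathbf{B}$ has finite fibres if for each map $g$ in $\mathbf{B}$ the set of maps $f$ in $\mathbf{A}$ with $Ff=g$ is finite (this implies the analogous condition on objects, so the sums above are finite). A small category $\mathbf{A}$ with object-set $\mathbf{A}_0$ is patch-finite if all hom-sets $\mathbf{A}(a,b)$ are finite and, for all $a,b\in\mathbf{A}_0$, the set of objects $c$ for which there exist maps $a\to c\to b$ is finite. Let $[a,b]_{\mathbf{A}}$ be the full subcategory on that set of objects. The algebra $k_{\mathrm p}\mathbf{A}$ is the set of functions $\alpha:\mathbf{A}_0\times\mathbf{A}_0\to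 k$ such that $\alpha(a,b)=0$ whenever $\mathbf{A}(a,b)=\emptyset$, with pointwise module structure, product $(\alpha*\beta)(a,b)=\sum_{c\in[a,b]_{\mathbf{A}}}\alpha(a,c)\beta(c,b)$, and unit the Kronecker delta. The coarse zeta function $\zeta_{\mathbf{A}}\in k_{\mathrm p}\mathbf{A}$ is $\zeta_{\mathbf{A}}(a,b)=\#\mathbf{A}(a,b)\in k$. $\mathbf{A}$ has coarse Möbius inversion (over $k$) if $\zeta_{\mathbf{A}}$ is invertible in $k_{\mathrm p}\mathbf{A}$; the inverse $\mu_{\mathbf{A}}$ is the coarse Möbius function (in particular $\mu_{\mathbf{A}}(a,b)=0$ if $\mathbf{A}(a,b)=\emptyset$). *)

theory Defs
  imports Main
begin

record ('o, 'm) cat =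
  Obj :: "'o set"
  Arr :: "'m set"
  Dom :: "'m \<Rightarrow> 'o"
  Cod :: "'m \<Rightarrow> 'o"
  Id :: "'o \<Rightarrow> 'm"
  Comp :: "'m \<Rightarrow> 'm \<Rightarrow> 'm"

definition Hom :: "('o, 'm) cat \<Rightarrow> 'o \<Rightarrow> 'o \<Rightarrow> 'm set" where
  "Hom C a b = {f \<in> Arr C. Dom C f = a \<and> Cod C f = b}"

text \<open>Composition is written in applicative order: \<open>Comp C g f\<close> is ``\<open>g\<close> after \<open>f\<close>''.\<close>

locale small_category =
  fixes C :: "('o, 'm) cat"
  assumes Dom_Obj: "f \<in> Arr C \<Longrightarrow> Dom C f \<in> Obj C"
    and Cod_Obj: "f \<in> Arr C \<Longrightarrow> Cod C f \<in> Obj C"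
    and Id_Hom: "a \<in> Obj C \<Longrightarrow> Id C a \<in> Hom C a a"
    and Comp_Hom: "f \<in> Hom C a b \<Longrightarrow> g \<in> Hom C b c \<Longrightarrow> Comp C g f \<in> Hom C a c"
    and Comp_Id_right: "f \<in> Hom C a b \<Longrightarrow> Comp C f (Id C a) = f"
    and Comp_Id_left: "f \<in> Hom C a b \<Longrightarrow> Comp C (Id C b) f = f"
    and Comp_assoc: "f \<in> Hom C a b \<Longrightarrow> g \<in> Hom C b c \<Longrightarrow> h \<in> Hom C c d
      \<Longrightarrow> Comp C h (Comp C g f) = Comp C (Comp C h g) f"

record ('o, 'm, 'p, 'n) fctr =
  omap :: "'o \<Rightarrow> 'p"
  amap :: "'m \<Rightarrow> 'n"

locale category_functor =
  dom_cat: small_category A + cod_cat: small_category B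
  for A :: "('o, 'm) cat" and B :: "('p, 'n) cat" +
  fixes F :: "('o, 'm, 'p, 'n) fctr"
  assumes omap_Obj: "a \<in> Obj A \<Longrightarrow> omap F a \<in> Obj B"
    and amap_Hom: "f \<in> Hom A a b \<Longrightarrow> amap F f \<in> Hom B (omap F a) (omap F b)"
    and amap_Id: "a \<in> Obj A \<Longrightarrow> amap F (Id A a) = Id B (omap F a)"
    and amap_Comp: "f \<in> Hom A a b \<Longrightarrow> g \<in> Hom A b c
      \<Longrightarrow> amap F (Comp A g f) = Comp B (amap F g) (amap F f)"

definition finite_fibres ::
    "('o, 'm) cat \<Rightarrow> ('p, 'n) cat \<Rightarrow> ('o, 'm, 'p, 'n) fctr \<Rightarrow> bool" where
  "finite_fibres A B F \<longleftrightarrow> (\<forall>g \<in> Arr B. finite {f \<in> Arr A. amap F f = g})"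

text \<open>\<open>F\<close> is left adjoint to \<open>G\<close>: bijections
  \<open>\<phi> a b : B(F a, b) \<rightarrow> A(a, G b)\<close>, natural in \<open>a\<close> and \<open>b\<close>.\<close>

definition left_adjoint ::
    "('o, 'm) cat \<Rightarrow> ('p, 'n) cat \<Rightarrow> ('o, 'm, 'p, 'n) fctr \<Rightarrow> ('p, 'n, 'o, 'm) fctr \<Rightarrow> bool" where
  "left_adjoint A B F G \<longleftrightarrow>
    (\<exists>\<phi> :: 'o \<Rightarrow> 'p \<Rightarrow> 'n \<Rightarrow> 'm.
      (\<forall>a \<in> Obj A. \<forall>b \<in> Obj B.
         bij_betw (\<phi> a b) (Hom B (omap F a) b) (Hom A a (omap G b))) \<and>
      (\<forall>a \<in> Obj A. \<forall>a' \<in> Obj A. \<forall>b \<in> Obj B. \<forall>b' \<in> Obj B.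
         \<forall>f \<in> Hom A a' a. \<forall>h \<in> Hom B (omap F a) b. \<forall>g \<in> Hom B b b'.
           \<phi> a' b' (Comp B g (Comp B h (amap F f))) =
             Comp A (amap G g) (Comp A (\<phi> a b h) f)))"

definition between :: "('o, 'm) cat \<Rightarrow> 'o \<Rightarrow> 'o \<Rightarrow> 'o set" where
  "between A a b = {c \<in> Obj A. Hom A a c \<noteq> {} \<and> Hom A c b \<noteq> {}}"

definition patch_finite :: "('o, 'm) cat \<Rightarrow> bool" where
  "patch_finite A \<longleftrightarrow>
    (\<forall>a \<in> Obj A. \<forall>b \<in> Obj A. finite (Hom A a b) \<and> finite (between A a b))"

text \<open>A function \<open>A\<^sub>0 \<times> A\<^sub>0 \<rightarrow> k\<close> is represented by a function on the whole type that is
  zero off the objects, so that equality in the algebra is equality in HOL. (In a category,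
  \<open>Hom A a b = {}\<close> unless \<open>a\<close> and \<open>b\<close> are objects.)\<close>

definition patch_algebra :: "('o, 'm) cat \<Rightarrow> ('o \<Rightarrow> 'o \<Rightarrow> 'k::comm_semiring_1) set" where
  "patch_algebra A = {\<alpha>. \<forall>a b. a \<notin> Obj A \<or> b \<notin> Obj A \<or> Hom A a b = {} \<longrightarrow> \<alpha> a b = 0}"

definition conv :: "('o, 'm) cat \<Rightarrow> ('o \<Rightarrow> 'o \<Rightarrow> 'k) \<Rightarrow> ('o \<Rightarrow> 'o \<Rightarrow> 'k)
    \<Rightarrow> 'o \<Rightarrow> 'o \<Rightarrow> 'k::comm_semiring_1" where
  "conv A \<alpha> \<beta> a b = (\<Sum>c \<in> between A a b. \<alpha> a c * \<beta> c b)"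

definition kronecker :: "('o, 'm) cat \<Rightarrow> 'o \<Rightarrow> 'o \<Rightarrow> 'k::comm_semiring_1" where
  "kronecker A a b = (if a \<in> Obj A \<and> a = b then 1 else 0)"

definition coarse_zeta :: "('o, 'm) cat \<Rightarrow> 'o \<Rightarrow> 'o \<Rightarrow> 'k::comm_semiring_1" where
  "coarse_zeta A a b = of_nat (card (Hom A a b))"

definition is_coarse_inverse ::
    "('o, 'm) cat \<Rightarrow> ('o \<Rightarrow> 'o \<Rightarrow> 'k::comm_semiring_1) \<Rightarrow> bool" where
  "is_coarse_inverse A \<mu> \<longleftrightarrow> \<mu> \<in> patch_algebra A \<and>
     conv A (coarse_zeta A) \<mu> = kronecker A \<and> conv A \<mu> (coarse_zeta A) = kronecker A"

definition has_coarse_moebius_inversion ::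
    "'k::comm_semiring_1 itself \<Rightarrow> ('o, 'm) cat \<Rightarrow> bool" where
  "has_coarse_moebius_inversion _ A \<longleftrightarrow>
     (\<exists>\<mu> :: 'o \<Rightarrow> 'o \<Rightarrow> 'k. is_coarse_inverse A \<mu>)"

definition coarse_moebius :: "('o, 'm) cat \<Rightarrow> 'o \<Rightarrow> 'o \<Rightarrow> 'k::comm_semiring_1" where
  "coarse_moebius A = (THE \<mu>. is_coarse_inverse A \<mu>)"

end

theory Submission imports Defs begin

text \<open>
  The adjunction gives \<open>\<zeta>\<^sub>B (F x) y = \<zeta>\<^sub>A x (G y)\<close>, so the double sum
  \<open>\<Sum>\<^sub>x \<Sum>\<^sub>y \<mu>\<^sub>A a x * \<zeta>\<^sub>B (F x) y * \<mu>\<^sub>B y b\<close> can be evaluated in two ways.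
  Summing over \<open>y\<close> first, \<open>\<zeta>\<^sub>B * \<mu>\<^sub>B = \<delta>\<close> leaves the terms with \<open>F x = b\<close>; after
  replacing \<open>\<zeta>\<^sub>B (F x) y\<close> by \<open>\<zeta>\<^sub>A x (G y)\<close> and summing over \<open>x\<close> first,
  \<open>\<mu>\<^sub>A * \<zeta>\<^sub>A = \<delta>\<close> leaves the terms with \<open>G y = a\<close>.

  The exchange of sums is legitimate because a nonzero term comes from chains
  \<open>F a \<rightarrow> F x \<rightarrow> y \<rightarrow> b\<close> and, transposed, \<open>a \<rightarrow> x \<rightarrow> G y \<rightarrow> G b\<close>: hence \<open>x\<close> lies
  between \<open>a\<close> and \<open>G b\<close>, and \<open>y\<close> lies between \<open>F a\<close> and \<open>b\<close>, two fixed finite sets.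
  The finite fibres guarantee that the two sums that remain are genuine finite sums.

  Lemma \<open>sum_inverses_over_adjoint_fibres\<close> carries this out for an arbitrary left inverse of
  \<open>\<zeta>\<^sub>A\<close> and an arbitrary right inverse of \<open>\<zeta>\<^sub>B\<close>. Applied to the identity adjunction, it says
  that any left inverse agrees with any right inverse, which is the uniqueness that makes
  \<^const>\<open>coarse_moebius\<close> well defined.
\<close>

lemma Hom_endpoints_Obj:
  assumes "small_category C" and "Hom C a b \<noteq> {}"
  shows "a \<in> Obj C" and "b \<in> Obj C"
  using assms small_category.Dom_Obj small_category.Cod_Obj unfolding Hom_def by fastforce+

lemma Hom_nonempty_trans:
  assumes "small_category C" and "Hom C a b \<noteq> {}" and "Hom C b c \<noteq> {}"
  shows "Hom C a c \<noteq> {}"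
  using assms small_category.Comp_Hom by fastforce

lemma coarse_zeta_in_patch_algebra:
  assumes "small_category C"
  shows "coarse_zeta C \<in> patch_algebra C"
  proof -
  have "Hom C a b = {}" if "a \<notin> Obj C \<or> b \<notin> Obj C" for a b
    using that Hom_endpoints_Obj[OF assms] by blast
  then show ?thesis unfolding patch_algebra_def coarse_zeta_def by auto
qed

text \<open>Terms outside \<^const>\<open>between\<close> vanish, so one index set can serve for a whole
  family of convolutions.\<close>

lemma conv_eq_sum_superset:
  assumes "\<alpha> \<in> patch_algebra C" and "\<beta> \<in> patch_algebra C"
    and "finite S" and "between C a b \<subseteq> S"
  shows "conv C \<alpha> \<beta> a b = (\<Sum>c \<in> S. \<alpha> a c * \<beta> c b)"
  unfolding conv_def
proof (rule sum.mono_neutral_left)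
  show "\<forall>c \<in> S - between C a b. \<alpha> a c * \<beta> c b = 0"
  proof
    fix c assume "c \<in> S - between C a b"
    then have "\<alpha> a c = 0 \<or> \<beta> c b = 0"
      using assms(1,2) unfolding between_def patch_algebra_def by blast
    then show "\<alpha> a c * \<beta> c b = 0" by auto
  qed
qed (use assms in auto)

text \<open>Finite fibres are a condition on maps; it passes to objects through identity maps.\<close>

lemma finite_object_fibre:
  assumes "category_functor A B F" and "finite_fibres A B F" and "b \<in> Obj B"
  shows "finite {a \<in> Obj A. omap F a = b}"
proof -
  interpret F: category_functor A B F by fact
  have "finite {f \<in> Arr A. amap F f = Id B b}"
    using assms(2,3) F.cod_cat.Id_Hom unfolding finite_fibres_def Hom_def by blast
  moreover have "{a \<in> Obj A. omap F a = b} \<subseteq> Dom A ` {f \<in> Arr A. amap F f = Id B b}"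
  proof
    fix a assume "a \<in> {a \<in> Obj A. omap F a = b}"
    then have "a = Dom A (Id A a)" and "Id A a \<in> {f \<in> Arr A. amap F f = Id B b}"
      using F.dom_cat.Id_Hom F.amap_Id unfolding Hom_def by auto
    then show "a \<in> Dom A ` {f \<in> Arr A. amap F f = Id B b}" by (rule image_eqI)
  qed
  ultimately show ?thesis by (rule finite_surj)
qed

lemma left_adjoint_card_Hom:
  assumes "left_adjoint A B F G" and "a \<in> Obj A" and "b \<in> Obj B"
  shows "card (Hom B (omap F a) b) = card (Hom A a (omap G b))"
  using assms bij_betw_same_card unfolding left_adjoint_def by blast

lemma left_adjoint_Hom_empty_iff:
  assumes "left_adjoint A B F G" and "a \<in> Obj A" and "b \<in> Obj B"
  shows "Hom B (omap F a) b = {} \<longleftrightarrow> Hom A a (omap G b) = {}"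
  using assms bij_betw_empty1 bij_betw_empty2 unfolding left_adjoint_def by metis

lemma sum_times_indicator:
  fixes f :: "'a \<Rightarrow> 'k::comm_semiring_1"
  assumes "finite S"
  shows "(\<Sum>x \<in> S. f x * (if P x then 1 else 0)) = (\<Sum>x \<in> {x \<in> S. P x}. f x)"
    and "(\<Sum>x \<in> S. (if P x then 1 else 0) * f x) = (\<Sum>x \<in> {x \<in> S. P x}. f x)"
  using assms by (simp_all add: sum.inter_filter if_distrib[of "\<lambda>z. f _ * z"]
      if_distrib[of "\<lambda>z. z * f _"] cong: if_cong)

text \<open>The two evaluations of the double sum. The one-sided inverses \<open>\<mu>\<close> and \<open>\<nu>\<close> are kept
  arbitrary so that the lemma can also be used to prove that inverses are unique.\<close>

lemma sum_inverses_over_adjoint_fibres: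
  fixes \<mu> :: "'o \<Rightarrow> 'o \<Rightarrow> 'k::comm_semiring_1" and \<nu> :: "'p \<Rightarrow> 'p \<Rightarrow> 'k"
    and A :: "('o, 'm) cat" and B :: "('p, 'n) cat"
  assumes F: "category_functor A B F" "finite_fibres A B F"
    and G: "category_functor B A G" "finite_fibres B A G"
    and adj: "left_adjoint A B F G"
    and pf: "patch_finite A" "patch_finite B"
    and \<mu>: "\<mu> \<in> patch_algebra A" "conv A \<mu> (coarse_zeta A) = kronecker A"
    and \<nu>: "\<nu> \<in> patch_algebra B" "conv B (coarse_zeta B) \<nu> = kronecker B"
    and ab: "a \<in> Obj A" "b \<in> Obj B"
  shows "(\<Sum>x \<in> {x \<in> Obj A. omap F x = b}. \<mu> a x) =
         (\<Sum>y \<in> {y \<in> Obj B. omap G y = a}. \<nu> y b)"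
proof -
  interpret F: category_functor A B F by fact
  interpret G: category_functor B A G by fact
  define S where "S = between A a (omap G b)"
  define T where "T = between B (omap F a) b"
  have Fa: "omap F a \<in> Obj B" and Gb: "omap G b \<in> Obj A"
    using ab F.omap_Obj G.omap_Obj by auto
  have fin: "finite S" "finite T"
    using pf ab Fa Gb unfolding S_def T_def patch_finite_def by auto
  have SD: "x \<in> Obj A" "Hom A a x \<noteq> {}" "Hom A x (omap G b) \<noteq> {}" if "x \<in> S" for x
    using that unfolding S_def between_def by auto
  have TD: "y \<in> Obj B" "Hom B (omap F a) y \<noteq> {}" "Hom B y b \<noteq> {}" if "y \<in> T" for y
    using that unfolding T_def between_def by auto
  note transA = Hom_nonempty_trans[OF F.dom_cat.small_category_axioms]
  note transB = Hom_nonempty_trans[OF F.cod_cat.small_category_axioms]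
  note zetaA = coarse_zeta_in_patch_algebra[OF F.dom_cat.small_category_axioms]
  note zetaB = coarse_zeta_in_patch_algebra[OF F.cod_cat.small_category_axioms]
  have Fmap: "Hom B (omap F x) (omap F x') \<noteq> {}" if "Hom A x x' \<noteq> {}" for x x'
    using that F.amap_Hom by blast
  have Gmap: "Hom A (omap G y) (omap G y') \<noteq> {}" if "Hom B y y' \<noteq> {}" for y y'
    using that G.amap_Hom by blast

  have inner_B: "(\<Sum>y \<in> T. coarse_zeta B (omap F x) y * \<nu> y b) = (if omap F x = b then 1 else 0)"
    if x: "x \<in> S" for x
  proof -
    have "between B (omap F x) b \<subseteq> T"
      using Fmap[OF SD(2)[OF x]] transB unfolding T_def between_def by blast
    then have "(\<Sum>y \<in> T. coarse_zeta B (omap F x) y * \<nu> y b) = kronecker B (omap F x) b"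
      using conv_eq_sum_superset[OF zetaB \<nu>(1) fin(2)] \<nu>(2) by metis
    then show ?thesis using F.omap_Obj SD(1)[OF x] by (simp add: kronecker_def)
  qed
  have inner_A: "(\<Sum>x \<in> S. \<mu> a x * coarse_zeta A x (omap G y)) = (if omap G y = a then 1 else 0)"
    if y: "y \<in> T" for y
  proof -
    have "between A a (omap G y) \<subseteq> S"
      using Gmap[OF TD(3)[OF y]] transA unfolding S_def between_def by blast
    then have "(\<Sum>x \<in> S. \<mu> a x * coarse_zeta A x (omap G y)) = kronecker A a (omap G y)"
      using conv_eq_sum_superset[OF \<mu>(1) zetaA fin(1)] \<mu>(2) by metis
    then show ?thesis using ab by (auto simp: kronecker_def)
  qed

  \<comment> \<open>If \<open>F x = b\<close>, then the transpose of the identity of \<open>b\<close> is a map \<open>x \<rightarrow> G b\<close>;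
    so \<open>x\<close> can lie outside \<open>S\<close> only for want of a map \<open>a \<rightarrow> x\<close>, and then \<open>\<mu> a x = 0\<close>.\<close>
  have "(\<Sum>x \<in> {x \<in> Obj A. omap F x = b}. \<mu> a x) = (\<Sum>x \<in> {x \<in> S. omap F x = b}. \<mu> a x)"
  proof (rule sum.mono_neutral_right)
    show "finite {x \<in> Obj A. omap F x = b}" using F ab(2) by (rule finite_object_fibre)
    show "{x \<in> S. omap F x = b} \<subseteq> {x \<in> Obj A. omap F x = b}" using SD(1) by blast
    show "\<forall>x \<in> {x \<in> Obj A. omap F x = b} - {x \<in> S. omap F x = b}. \<mu> a x = 0"
    proof
      fix x assume x: "x \<in> {x \<in> Obj A. omap F x = b} - {x \<in> S. omap F x = b}"
      then have "Hom B (omap F x) b \<noteq> {}" using F.cod_cat.Id_Hom ab(2) by blast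
      then have "Hom A x (omap G b) \<noteq> {}"
        using left_adjoint_Hom_empty_iff[OF adj _ ab(2)] x by blast
      then have "Hom A a x = {}" using x unfolding S_def between_def by blast
      then show "\<mu> a x = 0" using \<mu>(1) unfolding patch_algebra_def by blast
    qed
  qed
  also have "\<dots> = (\<Sum>x \<in> S. \<mu> a x * (\<Sum>y \<in> T. coarse_zeta B (omap F x) y * \<nu> y b))"
    using fin(1) inner_B by (simp add: sum_times_indicator)
  also have "\<dots> = (\<Sum>x \<in> S. \<Sum>y \<in> T. \<mu> a x * coarse_zeta A x (omap G y) * \<nu> y b)"
    using left_adjoint_card_Hom[OF adj SD(1) TD(1)]
    by (simp add: coarse_zeta_def sum_distrib_left mult.assoc)
  also have "\<dots> = (\<Sum>y \<in> T. \<Sum>x \<in> S. \<mu> a x * coarse_zeta A x (omap G y) * \<nu> y b)"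
    by (rule sum.swap)
  also have "\<dots> = (\<Sum>y \<in> T. (\<Sum>x \<in> S. \<mu> a x * coarse_zeta A x (omap G y)) * \<nu> y b)"
    by (simp add: sum_distrib_right)
  also have "\<dots> = (\<Sum>y \<in> {y \<in> T. omap G y = a}. \<nu> y b)"
    using fin(2) inner_A by (simp add: sum_times_indicator)
  \<comment> \<open>Dually, if \<open>G y = a\<close>, then the identity of \<open>a\<close> transposes to a map \<open>F a \<rightarrow> y\<close>.\<close>
  also have "\<dots> = (\<Sum>y \<in> {y \<in> Obj B. omap G y = a}. \<nu> y b)"
  proof (rule sum.mono_neutral_left)
    show "finite {y \<in> Obj B. omap G y = a}" using G ab(1) by (rule finite_object_fibre)
    show "{y \<in> T. omap G y = a} \<subseteq> {y \<in> Obj B. omap G y = a}" using TD(1) by blast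
    show "\<forall>y \<in> {y \<in> Obj B. omap G y = a} - {y \<in> T. omap G y = a}. \<nu> y b = 0"
    proof
      fix y assume y: "y \<in> {y \<in> Obj B. omap G y = a} - {y \<in> T. omap G y = a}"
      then have "Hom A a (omap G y) \<noteq> {}" using F.dom_cat.Id_Hom ab(1) by blast
      then have "Hom B (omap F a) y \<noteq> {}"
        using left_adjoint_Hom_empty_iff[OF adj ab(1)] y by blast
      then have "Hom B y b = {}" using y unfolding T_def between_def by blast
      then show "\<nu> y b = 0" using \<nu>(1) unfolding patch_algebra_def by blast
    qed
  qed
  finally show ?thesis .
qed

definition identity_functor :: "('o, 'm, 'o, 'm) fctr" where
  "identity_functor = \<lparr>omap = \<lambda>a. a, amap = \<lambda>f. f\<rparr>"

lemma category_functor_identity: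
  assumes "small_category C"
  shows "category_functor C C identity_functor"
  using assms
  by (auto simp: category_functor_def category_functor_axioms_def identity_functor_def)

lemma finite_fibres_identity: "finite_fibres C C identity_functor"
  by (simp add: finite_fibres_def identity_functor_def)

lemma left_adjoint_identity: "left_adjoint C C identity_functor identity_functor"
  unfolding left_adjoint_def
  by (rule exI[of _ "\<lambda>_ _ h. h"]) (simp add: identity_functor_def bij_betw_def)

text \<open>For the identity adjunction both fibres are singletons, so the fibre sums collapse to
  the single values \<open>\<mu> a b\<close> and \<open>\<nu> a b\<close>.\<close>

lemma coarse_inverse_unique:
  fixes C :: "('o, 'm) cat" and \<mu> \<nu> :: "'o \<Rightarrow> 'o \<Rightarrow> 'k::comm_semiring_1"
  assumes C: "small_category C" and "patch_finite C"
    and "is_coarse_inverse C \<mu>" and "is_coarse_inverse C \<nu>"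
  shows "\<mu> = \<nu>"
proof (intro ext)
  let ?I = "identity_functor :: ('o, 'm, 'o, 'm) fctr"
  fix a b
  have alg: "\<mu> \<in> patch_algebra C" "\<nu> \<in> patch_algebra C"
    using assms unfolding is_coarse_inverse_def by auto
  show "\<mu> a b = \<nu> a b"
  proof (cases "a \<in> Obj C \<and> b \<in> Obj C")
    case True
    then have "(\<Sum>x \<in> {x \<in> Obj C. omap ?I x = b}. \<mu> a x) =
               (\<Sum>y \<in> {y \<in> Obj C. omap ?I y = a}. \<nu> y b)"
      using assms unfolding is_coarse_inverse_def
      by (intro sum_inverses_over_adjoint_fibres[OF category_functor_identity[OF C]
            finite_fibres_identity category_functor_identity[OF C] finite_fibres_identity
            left_adjoint_identity]) auto
    moreover have "{x \<in> Obj C. omap ?I x = c} = {c}" if "c \<in> Obj C" for c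
      using that by (auto simp: identity_functor_def)
    ultimately show ?thesis using True by simp
  next
    case False
    then show ?thesis using alg unfolding patch_algebra_def by auto
  qed
qed

lemma coarse_moebius_is_coarse_inverse:
  fixes C :: "('o, 'm) cat"
  assumes "small_category C" and "patch_finite C"
    and "has_coarse_moebius_inversion TYPE('k::comm_semiring_1) C"
  shows "is_coarse_inverse C (coarse_moebius C :: 'o \<Rightarrow> 'o \<Rightarrow> 'k)"
proof -
  obtain \<mu> :: "'o \<Rightarrow> 'o \<Rightarrow> 'k" where "is_coarse_inverse C \<mu>"
    using assms(3) unfolding has_coarse_moebius_inversion_def by blast
  then show ?thesis
    unfolding coarse_moebius_def
    using coarse_inverse_unique[OF assms(1,2)] by (intro theI[of "is_coarse_inverse C"]) auto
qed

theorem proposition3p11: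
  fixes A :: "('o, 'm) cat" and B :: "('p, 'n) cat"
    and F :: "('o, 'm, 'p, 'n) fctr" and G :: "('p, 'n, 'o, 'm) fctr"
  assumes "\<forall>n::nat. of_nat n = (0::'k::comm_semiring_1) \<longrightarrow> n = 0"
    and "small_category A" and "patch_finite A"
    and "has_coarse_moebius_inversion TYPE('k) A"
    and "small_category B" and "patch_finite B"
    and "has_coarse_moebius_inversion TYPE('k) B"
    and "category_functor A B F" and "finite_fibres A B F"
    and "category_functor B A G" and "finite_fibres B A G"
    and "left_adjoint A B F G"
    and "a \<in> Obj A" and "b \<in> Obj B"
  shows "(\<Sum>a' \<in> {a' \<in> Obj A. omap F a' = b}. (coarse_moebius A a a' :: 'k)) =
         (\<Sum>b' \<in> {b' \<in> Obj B. omap G b' = a}. coarse_moebius B b' b)"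
proof -
  have "is_coarse_inverse A (coarse_moebius A :: 'o \<Rightarrow> 'o \<Rightarrow> 'k)"
    and "is_coarse_inverse B (coarse_moebius B :: 'p \<Rightarrow> 'p \<Rightarrow> 'k)"
    using assms coarse_moebius_is_coarse_inverse by auto
  then show ?thesis
    using assms unfolding is_coarse_inverse_def
    by (intro sum_inverses_over_adjoint_fibres) auto
qed

end
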